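(* Let $n>2$ be an integer and let $s_0=\sigma_0+it_0$ (with $\sigma_0,t_0\in\mathbb{R}$) be a simple zero of $G_n(s)=1+2^s+\dots+n^s$. Then there exist real numbers $\epsilon_1,\epsilon_2\ge 0$ with $\epsilon_1+\epsilon_2>0$ such that $(\sigma_0-\epsilon_1,\sigma_0+\epsilon_2)\subset R_n$.
   Context: For an integer $n\ge 2$, $G_n(s):=\sum_{m=1}^n m^s$ for $s\in\mathbb{C}$, where $m^s=e^{s\log m}$ with $\log m$ the real logarithm. $R_n:=\overline{\{\operatorname{Re} s: s\in\mathbb{C},\ G_n(s)=0\}}$ is the closure in $\mathbb{R}$ of the set of real parts of the zeros of $G_n$. *)

theory Defs
  imports "HOL-Complex_Analysis.Complex_Analysis"
begin

definition G :: "nat \<Rightarrow> complex \<Rightarrow> complex" where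
  "G n s = (\<Sum>m=1..n. of_nat m powr s)"

(* The complex powr is defined by means of the principal branch of the logarithm;
   on positive integers this is the real logarithm. *)
lemma G_altdef: "G n s = (\<Sum>m=1..n. exp (s * of_real (ln (real m))))"
  unfolding G_def
  by (intro sum.cong refl) (simp add: powr_def Ln_of_nat)

definition R :: "nat \<Rightarrow> real set" where
  "R n = closure {Re s | s. G n s = 0}"

definition simple_zero :: "(complex \<Rightarrow> complex) \<Rightarrow> complex \<Rightarrow> bool" where
  "simple_zero f z \<longleftrightarrow> f z = 0 \<and> zorder f z = 1"

end

theory Submission
  imports Defs
begin

text \<open>
  By Bertrand's postulate there is a prime \<open>q\<close> with \<open>n/2 < q \<le> n\<close>, so that \<open>q\<close> is its own only
  multiple up to \<open>n\<close>. Write \<open>G n s = q\<^sup>s (h s + 1)\<close>, where \<open>h s\<close> is the sum of \<open>(m/q)\<^sup>s\<close> over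
  \<open>m \<noteq> q\<close>. The logarithms of the primes are linearly independent over the rationals, so by
  Kronecker's theorem there are vertical translations that almost fix all \<open>m\<^sup>s\<close> with \<open>m \<noteq> q\<close> and
  rotate \<open>q\<^sup>s\<close> by a prescribed unimodular factor; with Hurwitz's theorem, \<open>|h s| = 1\<close> implies
  \<open>Re s \<in> R n\<close>. As \<open>h' s\<^sub>0 \<noteq> 0\<close> at a simple zero, an arc of the unit circle around \<open>-1 = h s\<^sub>0\<close>
  lifts through \<open>h\<close> to a curve through \<open>s\<^sub>0\<close>, whose real parts form a subinterval of \<open>R n\<close>. It is not
  a single point, since otherwise \<open>|h|\<close> would be constant on a vertical segment, hence
  \<open>h (\<sigma>\<^sub>0 + z) h (\<sigma>\<^sub>0 - z)\<close> would be constant in \<open>z\<close>, whereas it is unbounded on the positive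
  real axis.
\<close>

section \<open>Bertrand's postulate\<close>

lemma Suc_div_eq_div_plus: "Suc n div d = n div d + (if d dvd Suc n then 1 else 0)" if "d > 0"
  using that by (simp add: div_Suc dvd_eq_mod_eq_0)

text \<open>Passing from \<open>n\<close> to \<open>Suc n\<close> raises \<open>n div p ^ k\<close>
  by one exactly when \<open>p ^ k dvd Suc n\<close>, which happens for
  \<open>multiplicity p (Suc n)\<close> many \<open>k \<ge> 1\<close>. The bound \<open>N\<close> is
  fixed in advance so that the range of summation does not move during the induction.\<close>

lemma multiplicity_fact:
  fixes p :: nat
  assumes p: "prime p" and "n \<le> N"
  shows "multiplicity p (fact n) = (\<Sum>k=1..N. n div p ^ k)"
  using \<open>n \<le> N\<close>
proof (induction n)
  case 0
  show ?case by simp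
next
  case (Suc n)
  have p1: "p > 1" using p prime_gt_1_nat by blast
  have "multiplicity p (fact (Suc n)) = multiplicity p (Suc n) + multiplicity p (fact n :: nat)"
    using p by (simp add: prime_elem_multiplicity_mult_distrib del: mult_Suc)
  also have "multiplicity p (Suc n) = (\<Sum>k=1..N. if p ^ k dvd Suc n then 1 else 0)"
  proof -
    have iff: "p ^ k dvd Suc n \<longleftrightarrow> k \<le> multiplicity p (Suc n)" for k
      using p1 by (simp add: power_dvd_iff_le_multiplicity)
    have "p ^ multiplicity p (Suc n) \<le> Suc n"
      by (rule dvd_imp_le[OF multiplicity_dvd]) simp
    moreover have "multiplicity p (Suc n) < p ^ multiplicity p (Suc n)"
      using p1 by (intro power_gt_expt) auto
    ultimately have "multiplicity p (Suc n) \<le> N" using Suc.prems by linarith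
    hence "{k \<in> {1..N}. p ^ k dvd Suc n} = {1..multiplicity p (Suc n)}"
      unfolding iff by auto
    hence "multiplicity p (Suc n) = card {k \<in> {1..N}. p ^ k dvd Suc n}" by simp
    thus ?thesis by (simp add: sum.If_cases Int_def conj_commute)
  qed
  finally show ?case
    using Suc p1 by (simp add: Suc_div_eq_div_plus sum.distrib)
qed

lemma multiplicity_central_binomial:
  fixes p :: nat
  assumes p: "prime p"
  shows "multiplicity p ((2 * m) choose m) = (\<Sum>k=1..2*m. 2 * m div p ^ k - 2 * (m div p ^ k))"
proof -
  \<comment> \<open>Subtraction of naturals truncates, so it can be moved inside the sum only after
    this termwise comparison.\<close>
  have le: "2 * (m div d) \<le> 2 * m div d" for d
    by (metis div_mult1_eq le_add1)
  have "multiplicity p (fact m * fact m * ((2 * m) choose m)) = multiplicity p (fact (2 * m) :: nat)"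
    using binomial_fact_lemma[of m "2 * m"] by simp
  moreover have "multiplicity p (fact m * fact m * ((2 * m) choose m)) =
      2 * multiplicity p (fact m :: nat) + multiplicity p ((2 * m) choose m)"
    using p by (simp add: prime_elem_multiplicity_mult_distrib)
  ultimately have "multiplicity p ((2 * m) choose m) =
      multiplicity p (fact (2 * m) :: nat) - 2 * multiplicity p (fact m :: nat)"
    by simp
  also have "\<dots> = (\<Sum>k=1..2*m. 2 * m div p ^ k) - (\<Sum>k=1..2*m. 2 * (m div p ^ k))"
    using p by (simp add: multiplicity_fact[where N = "2 * m"] sum_distrib_left)
  also have "\<dots> = (\<Sum>k=1..2*m. 2 * m div p ^ k - 2 * (m div p ^ k))"
    by (rule sum_subtractf_nat [symmetric]) (rule le)
  finally show ?thesis .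
qed

lemma double_div_le: "2 * m div d - 2 * (m div d) \<le> (1::nat)"
proof (cases "d = 0")
  case False
  have "2 * m = 2 * (d * (m div d) + m mod d)" by simp
  also have "\<dots> < d * (2 * (m div d) + 2)"
    using False mod_less_divisor[of d m] by (simp only: ring_distribs) simp
  finally have "2 * m < d * (2 * (m div d) + 2)" .
  hence "2 * m div d < 2 * (m div d) + 2"
    using False by (simp add: less_mult_imp_div_less mult.commute)
  thus ?thesis by simp
qed auto

text \<open>Each Legendre term is at most 1 and vanishes once \<open>p ^ k > 2 * m\<close>. Hence
  the multiplicity is at most the number of \<open>k \<ge> 1\<close> with
  \<open>p ^ k \<le> 2 * m\<close>, which is at most the largest such \<open>k\<close>.\<close>

lemma prime_power_multiplicity_central_binomial_le:
  fixes p :: nat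
  assumes p: "prime p" and "m > 0"
  shows "p ^ multiplicity p ((2 * m) choose m) \<le> 2 * m"
proof -
  define K where "K = {k \<in> {1..2*m}. p ^ k \<le> 2 * m}"
  have p1: "p > 1" using p prime_gt_1_nat by blast
  have "multiplicity p ((2 * m) choose m) = (\<Sum>k=1..2*m. 2 * m div p ^ k - 2 * (m div p ^ k))"
    by (rule multiplicity_central_binomial) (fact p)
  also have "\<dots> \<le> (\<Sum>k=1..2*m. if p ^ k \<le> 2 * m then 1 else 0)"
    by (intro sum_mono) (use double_div_le in \<open>auto simp: not_le\<close>)
  also have "\<dots> = card K"
    by (simp add: K_def sum.If_cases Int_def conj_commute)
  finally have mult_le: "multiplicity p ((2 * m) choose m) \<le> card K" .
  show ?thesis
  proof (cases "K = {}")
    case True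
    thus ?thesis using mult_le \<open>m > 0\<close> by simp
  next
    case False
    have fin: "finite K" by (simp add: K_def)
    have "card K \<le> card {1..Max K}"
      by (intro card_mono) (use fin in \<open>auto simp: K_def\<close>)
    hence "p ^ multiplicity p ((2 * m) choose m) \<le> p ^ Max K"
      using p1 mult_le by (intro power_increasing) auto
    also have "\<dots> \<le> 2 * m"
      using Max_in[OF fin False] by (simp add: K_def)
    finally show ?thesis .
  qed
qed

text \<open>All Legendre terms vanish: for \<open>k = 1\<close> because
  \<open>2 * m div p \<le> 2\<close> while \<open>m div p \<ge> 1\<close>, and for larger
  \<open>k\<close> because \<open>p ^ k \<ge> 3 * p > 2 * m\<close>.\<close>

lemma not_dvd_central_binomial:
  fixes p :: nat
  assumes p: "prime p" "p > 2" and "2 * m < 3 * p" "p \<le> m"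
  shows "\<not> p dvd (2 * m) choose m"
proof -
  have "2 * m div p ^ k - 2 * (m div p ^ k) = 0" if k: "k \<in> {1..2*m}" for k
  proof (cases "k = 1")
    case True
    have "2 * m div p < 3" using assms by (intro less_mult_imp_div_less) simp
    moreover have "m div p \<ge> 1" using assms by (simp add: Suc_leI div_greater_zero_iff)
    ultimately show ?thesis using True by simp
  next
    case False
    have "2 * m < 3 * p" by fact
    also have "\<dots> \<le> p ^ 2" using p by (simp add: power2_eq_square)
    also have "\<dots> \<le> p ^ k" using False k p by (intro power_increasing) auto
    finally show ?thesis by simp
  qed
  hence "multiplicity p ((2 * m) choose m) = 0"
    using p by (simp add: multiplicity_central_binomial)
  thus ?thesis
    using p by (auto simp: multiplicity_eq_zero_iff)
qed

section \<open>Chebyshev's bound for the product of the primes up to n\<close>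

lemma prod_primes_dvd:
  assumes "finite A" "\<And>p. p \<in> A \<Longrightarrow> prime p" "\<And>p. p \<in> A \<Longrightarrow> p dvd (n :: nat)"
  shows "\<Prod>A dvd n"
  using assms
proof (induction A rule: finite_induct)
  case (insert p A)
  have "coprime p (\<Prod>A)"
    using insert by (intro prod_coprime_right primes_coprime) auto
  thus ?case using insert by (simp add: divides_mult)
qed auto

text \<open>The two middle entries of row \<open>2 * m + 1\<close> are equal, and together they are
  at most the row sum \<open>2 * 4 ^ m\<close>.\<close>

lemma central_binomial_odd_le: "(2 * m + 1) choose m \<le> 4 ^ m"
proof -
  have "2 * ((2 * m + 1) choose m) = ((2 * m + 1) choose m) + ((2 * m + 1) choose (m + 1))"
    using binomial_symmetric[of m "2 * m + 1"] by simp
  also have "\<dots> = (\<Sum>k\<in>{m,m+1}. (2 * m + 1) choose k)" by simp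
  also have "\<dots> \<le> (\<Sum>k\<le>2*m+1. (2 * m + 1) choose k)"
    by (intro sum_mono2) auto
  also have "\<dots> = 2 ^ (2 * m + 1)"
    by (rule choose_row_sum)
  also have "\<dots> = 2 * 4 ^ m"
    by (simp add: power_mult)
  finally show ?thesis by simp
qed

lemma prime_dvd_binomial:
  fixes p :: nat
  assumes "prime p" "p \<le> n" "k < p" "n - k < p" "k \<le> n"
  shows "p dvd n choose k"
proof -
  have "p dvd fact k * fact (n - k) * (n choose k)"
    using assms binomial_fact_lemma[of k n] by (simp add: prime_dvd_fact_iff)
  thus ?thesis using assms by (simp add: prime_dvd_mult_iff prime_dvd_fact_iff)
qed

text \<open>For odd \<open>n = 2 * m + 1\<close>, the primes in \<open>(m + 1, n]\<close> all divide
  \<open>n choose m\<close>, which is at most \<open>4 ^ m\<close>; induction handles the primes up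
  to \<open>m + 1\<close>. An even \<open>n > 2\<close> is not prime and reduces to
  \<open>n - 1\<close>.\<close>

lemma primorial_le: "\<Prod>{p::nat. prime p \<and> p \<le> n} \<le> 4 ^ n"
proof (induction n rule: less_induct)
  case (less n)
  have fin: "finite {p::nat. prime p \<and> p \<le> n}" for n by simp
  consider "n \<le> 2" | "n > 2" "even n" | m where "n = 2 * m + 1" "m > 0"
    by (metis oddE not_le zero_less_iff_neq_zero add_0 mult_0_right one_le_numeral)
  thus ?case
  proof cases
    case 1
    have "{p::nat. prime p \<and> p \<le> n} = (if n = 2 then {2} else {})"
    proof (rule set_eqI)
      fix p
      show "p \<in> {p. prime p \<and> p \<le> n} \<longleftrightarrow> p \<in> (if n = 2 then {2} else {})"
        using 1 prime_ge_2_nat[of p] by (cases "p = 2") auto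
    qed
    thus ?thesis by simp
  next
    case 2
    have "\<not> prime n" using 2 prime_odd_nat by auto
    hence "p \<noteq> n" if "prime p" for p using that by blast
    hence "{p. prime p \<and> p \<le> n} = {p. prime p \<and> p \<le> n - 1}"
      by (metis Suc_diff_1 gr_implies_not0 le_Suc_eq neq0_conv \<open>n > 2\<close>)
    hence "\<Prod>{p. prime p \<and> p \<le> n} \<le> 4 ^ (n - 1)" using less[of "n - 1"] 2 by simp
    also have "\<dots> \<le> 4 ^ n" by (intro power_increasing) auto
    finally show ?thesis .
  next
    case 3
    define B where "B = {p. prime p \<and> m + 1 < p \<and> p \<le> n}"
    have "\<Prod>B dvd n choose m"
      by (rule prod_primes_dvd) (use 3 in \<open>auto simp: B_def intro!: prime_dvd_binomial\<close>)
    hence "\<Prod>B \<le> n choose m" using 3 by (intro dvd_imp_le) auto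
    also have "\<dots> \<le> 4 ^ m" using central_binomial_odd_le[of m] 3 by simp
    finally have B: "\<Prod>B \<le> 4 ^ m" .
    have "{p. prime p \<and> p \<le> n} = {p. prime p \<and> p \<le> m + 1} \<union> B"
      using 3 by (auto simp: B_def)
    hence "\<Prod>{p. prime p \<and> p \<le> n} = \<Prod>{p. prime p \<and> p \<le> m + 1} * \<Prod>B"
      by (auto simp: B_def intro!: prod.union_disjoint)
    also have "\<dots> \<le> 4 ^ (m + 1) * 4 ^ m"
      using less[of "m + 1"] 3 B by (intro mult_mono) auto
    also have "\<dots> = 4 ^ n" using 3 by (simp add: mult_2 power_add)
    finally show ?thesis .
  qed
qed

section \<open>Conclusion of Bertrand's postulate\<close>

lemma Suc_power6_le: "s \<ge> 30 \<Longrightarrow> (s + 1) ^ 6 \<le> (2::nat) ^ s"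
proof (induction s rule: dec_induct)
  case (step s)
  \<comment> \<open>For \<open>s \<ge> 30\<close> the ratio of \<open>s + 2\<close> to
    \<open>s + 1\<close> is at most 32/31, and the sixth power of 32/31 is below 2.\<close>
  have "(31 * (Suc s + 1)) ^ 6 \<le> (32 * (s + 1)) ^ 6"
    using step by (intro power_mono) auto
  hence "31 ^ 6 * (Suc s + 1) ^ 6 \<le> 32 ^ 6 * (s + 1) ^ 6"
    by (simp only: power_mult_distrib)
  also have "\<dots> \<le> 31 ^ 6 * (2 * (s + 1) ^ 6)" by simp
  finally have "(Suc s + 1) ^ 6 \<le> 2 * (s + 1) ^ 6" by simp
  with step show ?case by simp
qed simp

text \<open>Erdos's argument: without a prime in \<open>(m, 2 * m]\<close>, every prime factor of
  \<open>C\<close> is at most \<open>2 * m / 3\<close>. Those up to \<open>s\<close> contribute at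
  most \<open>2 * m\<close> each, the others occur only once and together contribute at most
  \<open>4 ^ t\<close>. This is too small for \<open>4 ^ m \<le> 2 * m * C\<close>. The threshold
  450 is half of the square of 30 and gives \<open>s \<ge> 30\<close>.\<close>

lemma bertrand_large:
  fixes m :: nat
  assumes "m \<ge> 450"
  shows "\<exists>p. prime p \<and> m < p \<and> p \<le> 2 * m"
proof (rule ccontr)
  assume none: "\<not> ?thesis"
  define C where "C = (2 * m) choose m"
  define s where "s = floor_sqrt (2 * m)"
  have s: "s\<^sup>2 \<le> 2 * m" "2 * m < (s + 1)\<^sup>2"
    using Suc_floor_sqrt_power2_gt[of "2 * m"] by (simp_all add: s_def)
  have "s \<ge> 30"
  proof (rule ccontr)
    assume "\<not> ?thesis"
    hence "(s + 1)\<^sup>2 \<le> 30\<^sup>2" by (intro power_mono) auto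
    thus False using s assms by simp
  qed
  have C0: "C > 0" by (simp add: C_def)
  define t where "t = 2 * m div 3"
  have small: "p \<le> t" if "p \<in> prime_factors C" for p
  proof (rule ccontr)
    assume "\<not> p \<le> t"
    have p: "prime p" "p dvd C" using that by auto
    have "C dvd fact (2 * m)"
      using binomial_fact_lemma[of m "2*m"] unfolding C_def by (metis dvd_triv_right le_add1 mult_2)
    hence "p \<le> 2 * m" using p by (metis dvd_trans prime_dvd_fact_iff)
    hence "p \<le> m" using none p by (meson not_le)
    moreover have "2 * m < 3 * p" using \<open>\<not> p \<le> t\<close> by (simp add: t_def)
    ultimately show False
      using not_dvd_central_binomial[of p m] p assms by (simp add: C_def)
  qed
  define A where "A = {p \<in> prime_factors C. p \<le> s}"
  define B where "B = {p \<in> prime_factors C. \<not> p \<le> s}"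
  have fin: "finite A" "finite B" by (simp_all add: A_def B_def)
  have "C = (\<Prod>p\<in>prime_factors C. p ^ multiplicity p C)"
    using C0 by (simp add: prime_factorization_nat)
  also have "prime_factors C = A \<union> B" by (auto simp: A_def B_def)
  also have "(\<Prod>p\<in>A \<union> B. p ^ multiplicity p C) =
      (\<Prod>p\<in>A. p ^ multiplicity p C) * (\<Prod>p\<in>B. p ^ multiplicity p C)"
    by (intro prod.union_disjoint fin) (auto simp: A_def B_def)
  also have "\<dots> \<le> (2 * m) ^ (s - 1) * 4 ^ t"
  proof (intro mult_mono)
    \<comment> \<open>Since 1 is not prime, the exponent is only \<open>s - 1\<close>; this absorbs
      the extra factor \<open>2 * m\<close> of the lower bound for \<open>C\<close> later.\<close>
    have "A \<subseteq> {2..s}"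
    proof
      fix p assume "p \<in> A"
      hence "prime p" "p \<le> s" by (auto simp: A_def)
      thus "p \<in> {2..s}" using prime_ge_2_nat[of p] by simp
    qed
    hence "card A \<le> s - 1" using card_mono[of "{2..s}" A] by simp
    have "(\<Prod>p\<in>A. p ^ multiplicity p C) \<le> (\<Prod>p\<in>A. 2 * m)"
    proof (intro prod_mono conjI)
      fix p assume "p \<in> A"
      hence "prime p" by (auto simp: A_def)
      thus "p ^ multiplicity p C \<le> 2 * m"
        unfolding C_def using assms by (intro prime_power_multiplicity_central_binomial_le) auto
    qed auto
    also have "\<dots> = (2 * m) ^ card A" by simp
    also have "\<dots> \<le> (2 * m) ^ (s - 1)" using assms \<open>card A \<le> s - 1\<close> by (intro power_increasing) auto
    finally show "(\<Prod>p\<in>A. p ^ multiplicity p C) \<le> (2 * m) ^ (s - 1)" .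
  next
    have "(\<Prod>p\<in>B. p ^ multiplicity p C) \<le> (\<Prod>p\<in>B. p)"
    proof (intro prod_mono conjI)
      fix p assume p: "p \<in> B"
      hence "prime p" by (auto simp: B_def)
      have "multiplicity p C \<le> 1"
      proof (rule ccontr)
        assume "\<not> ?thesis"
        hence "p ^ 2 \<le> p ^ multiplicity p C"
          using \<open>prime p\<close> by (intro power_increasing) (auto simp: prime_gt_0_nat Suc_leI)
        also have "\<dots> \<le> 2 * m"
          unfolding C_def using \<open>prime p\<close> assms by (intro prime_power_multiplicity_central_binomial_le) auto
        also have "\<dots> < (s + 1)\<^sup>2" by (fact s)
        finally have "p < s + 1" by (rule power_less_imp_less_base) simp
        thus False using p by (simp add: B_def)
      qed
      hence "p ^ multiplicity p C \<le> p ^ 1"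
        using \<open>prime p\<close> by (intro power_increasing) (auto simp: prime_gt_0_nat Suc_leI)
      thus "p ^ multiplicity p C \<le> p" by simp
    qed auto
    also have "\<dots> \<le> \<Prod>{p. prime p \<and> p \<le> t}"
      by (intro dvd_imp_le prod_dvd_prod_subset prod_pos)
         (use small in \<open>auto simp: B_def prime_gt_0_nat\<close>)
    also have "\<dots> \<le> 4 ^ t" by (rule primorial_le)
    finally show "(\<Prod>p\<in>B. p ^ multiplicity p C) \<le> 4 ^ t" .
  qed auto
  finally have C_le: "C \<le> (2 * m) ^ (s - 1) * 4 ^ t" .
  have "real (4 ^ m) \<le> real (2 * m * C)"
    using central_binomial_lower_bound[of m] assms by (simp add: C_def field_simps)
  hence "4 ^ m \<le> 2 * m * C" using of_nat_le_iff by blast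
  also have "\<dots> \<le> 2 * m * ((2 * m) ^ (s - 1) * 4 ^ t)" using C_le by (rule mult_le_mono2)
  also have "\<dots> = (2 * m) ^ s * 4 ^ t"
    using \<open>s \<ge> 30\<close> by (cases s) auto
  also have "(4::nat) ^ m = 4 ^ (m - t) * 4 ^ t"
    by (simp add: t_def flip: power_add)
  finally have "4 ^ (m - t) \<le> (2 * m) ^ s" by simp
  \<comment> \<open>The contradiction is \<open>2 ^ (s * s) < 2 ^ (s * s)\<close>. Cubing clears the
    denominator in \<open>m - t \<ge> m / 3\<close>, and then \<open>2 * m\<close> is replaced by
    the larger \<open>(s + 1)\<^sup>2\<close>.\<close>
  have "2 ^ (s * s) \<le> (2::nat) ^ (2 * m)"
    using s by (intro power_increasing) (auto simp: power2_eq_square)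
  also have "\<dots> = 4 ^ m" by (simp add: power_mult)
  also have "\<dots> \<le> 4 ^ ((m - t) * 3)"
    by (intro power_increasing) (auto simp: t_def)
  also have "\<dots> = (4 ^ (m - t)) ^ 3" by (simp add: power_mult)
  also have "\<dots> \<le> ((2 * m) ^ s) ^ 3" using \<open>4 ^ (m - t) \<le> (2 * m) ^ s\<close> by (intro power_mono) auto
  also have "\<dots> = (2 * m) ^ (s * 3)" by (simp add: power_mult)
  also have "\<dots> < ((s + 1)\<^sup>2) ^ (s * 3)" using s \<open>s \<ge> 30\<close> by (intro power_strict_mono) auto
  also have "\<dots> = ((s + 1) ^ 6) ^ s" by (simp flip: power_mult add: mult_ac)
  also have "\<dots> \<le> (2 ^ s) ^ s" using \<open>s \<ge> 30\<close> by (intro power_mono Suc_power6_le) auto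
  finally show False by (simp add: power_mult)
qed

lemma bertrand:
  fixes m :: nat
  assumes "m \<ge> 1"
  shows "\<exists>p. prime p \<and> m < p \<and> p \<le> 2 * m"
proof (cases "m \<ge> 450")
  case False
  \<comment> \<open>Landau's chain 2, 3, 5, 7, 13, 23, 43, 83, 163, 317, 631: each prime is less
    than twice its predecessor, so the first one above \<open>m\<close> is at most
    \<open>2 * m\<close>.\<close>
  consider "m < 2" | "m \<ge> 2" "m < 3" | "m \<ge> 3" "m < 5" | "m \<ge> 5" "m < 7" | "m \<ge> 7" "m < 13"
    | "m \<ge> 13" "m < 23" | "m \<ge> 23" "m < 43" | "m \<ge> 43" "m < 83" | "m \<ge> 83" "m < 163"
    | "m \<ge> 163" "m < 317" | "m \<ge> 317" "m < 631"
    using False by linarith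
  thus ?thesis
  proof cases
    case 1
    thus ?thesis using assms by (intro exI[of _ 2]) simp
  next
    case 2
    thus ?thesis using assms by (intro exI[of _ 3]) simp
  next
    case 3
    thus ?thesis using assms by (intro exI[of _ 5]) simp
  next
    case 4
    thus ?thesis using assms by (intro exI[of _ 7]) simp
  next
    case 5
    thus ?thesis using assms by (intro exI[of _ 13]) simp
  next
    case 6
    thus ?thesis using assms by (intro exI[of _ 23]) simp
  next
    case 7
    thus ?thesis using assms by (intro exI[of _ 43]) simp
  next
    case 8
    thus ?thesis using assms by (intro exI[of _ 83]) simp
  next
    case 9
    thus ?thesis using assms by (intro exI[of _ 163]) simp
  next
    case 10
    thus ?thesis using assms by (intro exI[of _ 317]) simp
  next
    case 11
    thus ?thesis using assms by (intro exI[of _ 631]) simp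
  qed
qed (rule bertrand_large)

lemma ex_prime_gt_half:
  assumes "n \<ge> 2"
  obtains q :: nat where "prime q" "q \<le> n" "n < 2 * q"
proof -
  have "n div 2 \<ge> 1" using assms by simp
  then obtain q where "prime q" "n div 2 < q" "q \<le> 2 * (n div 2)"
    using bertrand by blast
  thus ?thesis using that[of q] by linarith
qed

section \<open>Kronecker's theorem for the logarithms of primes\<close>

text \<open>Separating positive and negative coefficients turns the relation into an equality of two
  products of prime powers, and unique factorization applies.\<close>

lemma sum_ln_primes_eq_0:
  fixes c :: "nat \<Rightarrow> int"
  assumes fin: "finite P" and P: "\<And>p. p \<in> P \<Longrightarrow> prime p"
    and eq: "(\<Sum>p\<in>P. of_int (c p) * ln (real p)) = 0" and "p \<in> P"
  shows "c p = 0"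
proof -
  define A where "A = (\<Prod>p\<in>P. p ^ nat (c p))"
  define B where "B = (\<Prod>p\<in>P. p ^ nat (- c p))"
  have pos: "real p > 0" if "p \<in> P" for p using P[OF that] prime_gt_0_nat by simp
  have ln: "ln (real (\<Prod>p\<in>P. p ^ f p)) = (\<Sum>p\<in>P. real (f p) * ln (real p))" for f
    using fin pos by (simp add: ln_prod ln_realpow)
  have "ln (real A) - ln (real B) = (\<Sum>p\<in>P. (real (nat (c p)) - real (nat (- c p))) * ln (real p))"
    unfolding A_def B_def ln by (simp add: sum_subtractf left_diff_distrib)
  also have "\<dots> = (\<Sum>p\<in>P. of_int (c p) * ln (real p))"
  proof (intro sum.cong refl)
    fix p
    have "real (nat (c p)) - real (nat (- c p)) = of_int (c p)" by (cases "c p \<ge> 0") auto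
    thus "(real (nat (c p)) - real (nat (- c p))) * ln (real p) = of_int (c p) * ln (real p)" by simp
  qed
  finally have "ln (real A) = ln (real B)" using eq by simp
  moreover have "A > 0" "B > 0"
    using pos by (auto simp: A_def B_def intro!: prod_pos)
  ultimately have "A = B" by simp
  hence "multiplicity p A = multiplicity p B" by simp
  \<comment> \<open>As \<open>nat\<close> sends negative integers to 0, one of the two sides is 0,
    hence both are.\<close>
  hence "nat (c p) = nat (- c p)"
    unfolding A_def B_def using assms by (simp add: multiplicity_prod_prime_powers)
  thus ?thesis by linarith
qed

text \<open>Kronecker's theorem expects independence over the integers in the language of modules;
  the factor \<open>r\<close> makes room for the normalization by \<open>2 * pi\<close>.\<close>

lemma independent_ln_primes:
  assumes P: "\<And>p. p \<in> P \<Longrightarrow> prime (p :: nat)" and r: "r \<noteq> (0 :: real)"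
  shows "module.independent (\<lambda>r. (*) (real_of_int r)) ((\<lambda>p. ln (real p) / r) ` P)"
proof -
  interpret Modules.module "\<lambda>r. (*) (real_of_int r)"
    by (simp add: Modules.module.intro distrib_left mult.commute)
  have inj: "inj_on (\<lambda>p. ln (real p) / r) P"
    using P r prime_gt_0_nat by (auto simp: inj_on_def)
  show ?thesis
    unfolding independent_explicit_module
  proof (intro allI impI)
    fix T :: "real set" and u :: "real \<Rightarrow> int" and v :: real
    assume T: "finite T" "T \<subseteq> (\<lambda>p. ln (real p) / r) ` P" "(\<Sum>v\<in>T. of_int (u v) * v) = 0" "v \<in> T"
    then obtain Q where Q: "Q \<subseteq> P" "T = (\<lambda>p. ln (real p) / r) ` Q"
      by (meson subset_imageE)
    have injQ: "inj_on (\<lambda>p. ln (real p) / r) Q"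
      using inj Q inj_on_subset by blast
    have "(\<Sum>p\<in>Q. of_int (u (ln (real p) / r)) * ln (real p)) = r * (\<Sum>v\<in>T. of_int (u v) * v)"
      using r unfolding Q sum.reindex[OF injQ] by (simp add: sum_distrib_left)
    also have "\<dots> = 0" using T by simp
    finally have *: "(\<Sum>p\<in>Q. of_int (u (ln (real p) / r)) * ln (real p)) = 0" .
    have "finite Q" using T Q injQ finite_image_iff by blast
    have "u (ln (real p) / r) = 0" if "p \<in> Q" for p
      by (rule sum_ln_primes_eq_0[OF \<open>finite Q\<close> _ * that]) (use P Q in auto)
    thus "u v = 0" using T Q by auto
  qed
qed

text \<open>Kronecker's theorem approximates all \<open>\<alpha> p / (2 * pi)\<close> simultaneously
  by \<open>t * \<theta> p\<close> modulo integers. Taking the error below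
  \<open>1 / (N + 1)\<close> gives a sequence of translations, the form suited to Hurwitz's
  theorem.\<close>

lemma kronecker_primes:
  fixes \<alpha> :: "nat \<Rightarrow> real"
  assumes P: "finite P" "\<And>p. p \<in> P \<Longrightarrow> prime p"
  obtains t :: "nat \<Rightarrow> real"
    where "\<And>p. p \<in> P \<Longrightarrow> (\<lambda>N. cis (t N * ln (real p))) \<longlonglongrightarrow> cis (\<alpha> p)"
proof -
  obtain f where f: "bij_betw f {..<card P} P"
    using ex_bij_betw_nat_finite[OF P(1)] by (auto simp: atLeast0LessThan)
  define \<theta> where "\<theta> = (\<lambda>p. ln (real p) / (2 * pi))"
  have img: "(\<lambda>i. \<theta> (f i)) ` {..<card P} = \<theta> ` P"
    using f by (metis bij_betw_imp_surj_on image_image)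
  have "inj_on \<theta> P"
    using P prime_gt_0_nat by (auto simp: inj_on_def \<theta>_def)
  hence inj: "inj_on (\<lambda>i. \<theta> (f i)) {..<card P}"
    using f by (metis bij_betw_def comp_inj_on_iff comp_def[symmetric] o_def)
  have "\<exists>t h. \<forall>p\<in>P. \<bar>t * \<theta> p - of_int (h p) - \<alpha> p / (2 * pi)\<bar> < inverse (Suc N)" for N
  proof -
    have ind: "module.independent (\<lambda>r. (*) (real_of_int r)) ((\<lambda>i. \<theta> (f i)) ` {..<card P})"
      unfolding img unfolding \<theta>_def by (rule independent_ln_primes) (use P in auto)
    obtain t h where th: "\<And>i. i < card P \<Longrightarrow>
        \<bar>t * \<theta> (f i) - of_int (h i) - \<alpha> (f i) / (2 * pi)\<bar> < inverse (Suc N)"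
      using Kronecker_thm_1[OF ind inj, of "inverse (Suc N)" "\<lambda>i. \<alpha> (f i) / (2 * pi)"] by auto
    have "\<exists>i<card P. p = f i" if "p \<in> P" for p
      using f that by (auto simp: bij_betw_def)
    hence "\<forall>p\<in>P. \<exists>k::int. \<bar>t * \<theta> p - of_int k - \<alpha> p / (2 * pi)\<bar> < inverse (Suc N)"
      using th by metis
    thus ?thesis by metis
  qed
  then obtain t h where th: "\<And>N p. p \<in> P \<Longrightarrow>
      \<bar>t N * \<theta> p - of_int (h N p) - \<alpha> p / (2 * pi)\<bar> < inverse (Suc N)"
    by metis
  show ?thesis
  proof (rule that[of t])
    fix p assume p: "p \<in> P"
    define \<delta> where "\<delta> = (\<lambda>N. t N * \<theta> p - of_int (h N p) - \<alpha> p / (2 * pi))"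
    have "\<delta> \<longlonglongrightarrow> 0"
    proof (rule Lim_null_comparison)
      show "\<forall>\<^sub>F N in sequentially. norm (\<delta> N) \<le> inverse (Suc N)"
        using th[OF p] by (auto simp: \<delta>_def less_imp_le)
    qed (rule LIMSEQ_inverse_real_of_nat)
    hence "(\<lambda>N. cis (\<alpha> p + 2 * pi * \<delta> N)) \<longlonglongrightarrow> cis (\<alpha> p + 2 * pi * 0)"
      by (intro tendsto_intros)
    moreover have "cis (t N * ln (real p)) = cis (\<alpha> p + 2 * pi * \<delta> N)" for N
    proof -
      \<comment> \<open>The integer \<open>h N p\<close> contributes full periods of
        \<open>cis\<close> and drops out.\<close>
      have "t N * ln (real p) = (\<alpha> p + 2 * pi * \<delta> N) + 2 * pi * of_int (h N p)"
        by (simp add: \<delta>_def \<theta>_def field_simps)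
      thus ?thesis by (simp only: flip: cis_mult) simp
    qed
    ultimately show "(\<lambda>N. cis (t N * ln (real p))) \<longlonglongrightarrow> cis (\<alpha> p)" by simp
  qed
qed

lemma uniform_limit_sum:
  fixes f :: "'a \<Rightarrow> 'b \<Rightarrow> 'c \<Rightarrow> 'd :: real_normed_vector"
  assumes "\<And>i. i \<in> I \<Longrightarrow> uniform_limit X (f i) (g i) F"
  shows "uniform_limit X (\<lambda>x y. \<Sum>i\<in>I. f i x y) (\<lambda>y. \<Sum>i\<in>I. g i y) F"
  using assms
  by (induction I rule: infinite_finite_induct) (auto intro!: uniform_limit_add uniform_limit_const)

section \<open>Twisted Dirichlet polynomials\<close>

lemma powr_plus_imaginary:
  assumes "m > 0"
  shows "of_nat m powr (s + \<i> * of_real t) = of_nat m powr s * cis (t * ln (real m))"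
  using assms by (simp add: powr_def Ln_of_nat cis_conv_exp ring_distribs exp_add mult_ac flip: of_real_mult)

definition twisted_sum :: "nat \<Rightarrow> nat \<Rightarrow> complex \<Rightarrow> complex \<Rightarrow> complex" where
  "twisted_sum n q u s = (\<Sum>m=1..n. (if m = q then u else 1) * of_nat m powr s)"

lemma twisted_sum_split:
  assumes "q \<in> {1..n}"
  shows "twisted_sum n q u s = (\<Sum>m\<in>{1..n} - {q}. of_nat m powr s) + u * of_nat q powr s"
  unfolding twisted_sum_def using assms by (subst sum.remove[of _ q]) auto

lemma holomorphic_twisted_sum: "twisted_sum n q u holomorphic_on S"
  unfolding twisted_sum_def[abs_def] by (intro holomorphic_intros)

lemma twisted_sum_1: "twisted_sum n q 1 = G n"
  by (simp add: fun_eq_iff twisted_sum_def G_def)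

text \<open>Along \<open>s = 0, -1, -2, ...\<close> every term with \<open>m > 1\<close> tends to 0,
  so the sum tends to the coefficient at \<open>m = 1\<close>, which is 1 because
  \<open>q > 1\<close>. This supplies the nonconstancy for Hurwitz's theorem.\<close>

lemma twisted_sum_not_identically_zero:
  assumes "n \<ge> 1" "q > 1"
  obtains s where "twisted_sum n q u s \<noteq> 0"
proof -
  have "(\<lambda>k. twisted_sum n q u (- of_nat k)) \<longlonglongrightarrow> (\<Sum>m=1..n. if m = 1 then 1 else 0)"
    unfolding twisted_sum_def
  proof (intro tendsto_sum)
    fix m assume m: "m \<in> {1..n}"
    show "(\<lambda>k. (if m = q then u else 1) * of_nat m powr - of_nat k) \<longlonglongrightarrow> (if m = 1 then 1 else (0::complex))"
    proof (cases "m = 1")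
      case False
      have eq: "of_nat m powr - of_nat k = (inverse (of_nat m) :: complex) ^ k" for k
        using m by (simp add: powr_minus power_inverse)
      have "(\<lambda>k. (inverse (of_nat m) :: complex) ^ k) \<longlonglongrightarrow> 0"
        using False m by (intro LIMSEQ_power_zero) (auto simp: norm_inverse inverse_less_1_iff)
      from tendsto_mult_left[OF this, of "if m = q then u else 1"]
      show ?thesis using False by (simp add: eq)
    qed (use assms in auto)
  qed
  moreover have "(\<Sum>m=1..n. if m = 1 then 1 else 0) = (1 :: complex)"
    by (subst sum.delta) (use assms in auto)
  ultimately have lim: "(\<lambda>k. twisted_sum n q u (- of_nat k)) \<longlonglongrightarrow> 1" by simp
  show ?thesis
  proof (rule ccontr)
    assume "\<not> thesis"
    hence "twisted_sum n q u s = 0" for s using that by blast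
    with lim show False by (simp add: LIMSEQ_const_iff)
  qed
qed

text \<open>The function \<open>cis (t * ln m)\<close> is completely multiplicative in
  \<open>m\<close>, so the limit 1 passes from the primes other than \<open>q\<close> to their
  products.\<close>

lemma cis_ln_tendsto_1:
  fixes t :: "nat \<Rightarrow> real"
  assumes lim: "\<And>p. prime p \<Longrightarrow> p \<le> n \<Longrightarrow> p \<noteq> q \<Longrightarrow> (\<lambda>N. cis (t N * ln (real p))) \<longlonglongrightarrow> 1"
    and "0 < m" "m \<le> n" "\<not> q dvd m"
  shows "(\<lambda>N. cis (t N * ln (real m))) \<longlonglongrightarrow> 1"
  using assms(2-)
proof (induction m rule: less_induct)
  case (less m)
  show ?case
  proof (cases "m = 1")
    case False
    then obtain p where p: "prime p" "p dvd m" using prime_factor_nat by blast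
    then obtain k where k: "m = p * k" by auto
    have "p \<le> m" "p \<noteq> q" "k > 0" "p > 1"
      using p less.prems k prime_gt_1_nat[of p] by (auto intro: dvd_imp_le)
    have "k < m" using k \<open>k > 0\<close> \<open>p > 1\<close> by simp
    have "k \<le> n" using \<open>k < m\<close> less.prems by linarith
    have "\<not> q dvd k" using less.prems k by auto
    have "(\<lambda>N. cis (t N * ln (real p)) * cis (t N * ln (real k))) \<longlonglongrightarrow> 1 * 1"
    proof (intro tendsto_mult)
      show "(\<lambda>N. cis (t N * ln (real p))) \<longlonglongrightarrow> 1"
        using p \<open>p \<le> m\<close> \<open>p \<noteq> q\<close> less.prems by (intro lim) auto
      show "(\<lambda>N. cis (t N * ln (real k))) \<longlonglongrightarrow> 1"
        by (rule less.IH) fact+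
    qed
    moreover have "cis (t N * ln (real m)) = cis (t N * ln (real p)) * cis (t N * ln (real k))" for N
      using k \<open>k > 0\<close> \<open>p > 1\<close> by (simp add: cis_mult ln_mult ring_distribs)
    ultimately show ?thesis by simp
  qed simp
qed

text \<open>By Kronecker's theorem, the vertical translates of \<^term>\<open>G n\<close> approximate the twisted sum
  (multiples of \<^term>\<open>q\<close> other than \<^term>\<open>q\<close> itself do not occur), so Hurwitz's theorem yields
  zeros of \<^term>\<open>G n\<close> whose real parts approach that of a zero of the twisted sum.\<close>

lemma twisted_zero_in_R:
  assumes q: "prime q" "q \<le> n" "n < 2 * q" and u: "norm u = 1"
    and z: "twisted_sum n q u z = 0"
  shows "Re z \<in> R n"
proof (rule ccontr)
  assume "Re z \<notin> R n"
  \<comment> \<open>A gap around \<open>Re z\<close> is unaffected by vertical translation, so every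
    translate \<open>F N\<close> is free of zeros on \<open>ball z e\<close>. Hurwitz's theorem then
    contradicts the zero of the limit at \<open>z\<close>.\<close>
  then obtain e where e: "e > 0" "\<And>s. G n s = 0 \<Longrightarrow> \<bar>Re s - Re z\<bar> \<ge> e"
    unfolding R_def closure_approachable by (force simp: dist_real_def not_less)
  obtain a where a: "u = cis a" using u by (metis rcis_cmod_Arg rcis_def mult_1 of_real_1)
  obtain t :: "nat \<Rightarrow> real" where t: "\<And>p. prime p \<Longrightarrow> p \<le> n \<Longrightarrow>
      (\<lambda>N. cis (t N * ln (real p))) \<longlonglongrightarrow> cis (if p = q then a else 0)"
    by (rule kronecker_primes[of "{p. prime p \<and> p \<le> n}" "\<lambda>p. if p = q then a else 0"]) auto
  have t1: "(\<lambda>N. cis (t N * ln (real p))) \<longlonglongrightarrow> 1" if "prime p" "p \<le> n" "p \<noteq> q" for p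
    using t[OF that(1,2)] that(3) by simp
  have lim: "(\<lambda>N. cis (t N * ln (real m))) \<longlonglongrightarrow> (if m = q then u else 1)" if m: "m \<in> {1..n}" for m
  proof (cases "m = q")
    case True
    thus ?thesis using t[OF q(1,2)] a by simp
  next
    case False
    have "\<not> q dvd m"
    proof
      assume "q dvd m"
      then obtain k where k: "m = q * k" by auto
      have "q * k \<le> n" using m k by simp
      hence "q * k < q * 2" using q(3) by linarith
      hence "k < 2" by simp
      thus False using k False m by (cases "k = 0") auto
    qed
    thus ?thesis using cis_ln_tendsto_1[of n q t m, OF t1] m False by auto
  qed
  define F where "F = (\<lambda>N s. G n (s + \<i> * of_real (t N)))"
  have F_eq: "F N s = (\<Sum>m=1..n. cis (t N * ln (real m)) * of_nat m powr s)" for N s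
    unfolding F_def G_def by (intro sum.cong refl) (simp add: powr_plus_imaginary)
  have "twisted_sum n q u z \<noteq> 0"
  proof (rule Hurwitz_no_zeros[of "ball z e" F "twisted_sum n q u" z])
    show "F N holomorphic_on ball z e" for N
      unfolding F_def G_def by (intro holomorphic_intros)
    show "uniform_limit K F (twisted_sum n q u) sequentially" if "compact K" for K
      unfolding F_eq[abs_def] twisted_sum_def[abs_def]
    proof (rule uniform_limit_sum)
      fix m assume m: "m \<in> {1..n}"
      have "compact ((\<lambda>s. of_nat m powr s :: complex) ` K)"
        using that m by (intro compact_continuous_image continuous_intros) auto
      moreover have "uniform_limit K (\<lambda>N _. cis (t N * ln (real m))) (\<lambda>_. if m = q then u else 1) sequentially"
        using lim[OF m] by (auto simp: uniform_limit_iff tendsto_iff)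
      ultimately show "uniform_limit K (\<lambda>N s. cis (t N * ln (real m)) * of_nat m powr s)
          (\<lambda>s. (if m = q then u else 1) * of_nat m powr s) sequentially"
        by (intro uniform_lim_mult uniform_limit_const) (auto simp: image_constant_conv intro: compact_imp_bounded)
    qed
    show "\<not> twisted_sum n q u constant_on ball z e"
    proof
      assume "twisted_sum n q u constant_on ball z e"
      then obtain k where k: "\<And>s. s \<in> ball z e \<Longrightarrow> twisted_sum n q u s = k"
        by (auto simp: constant_on_def)
      \<comment> \<open>A constant value on the ball would be the value 0 at \<open>z\<close>, and
        analytic continuation would make the twisted sum vanish everywhere.\<close>
      have "k = 0" using k[of z] z e(1) by simp
      with k have zero: "twisted_sum n q u s = 0" if "s \<in> ball z e" for s using that by blast
      have "twisted_sum n q u s = 0" for s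
        by (rule analytic_continuation[of _ UNIV "ball z e" z, OF holomorphic_twisted_sum])
           (use zero e(1) in \<open>auto intro: islimpt_ball\<close>)
      moreover obtain s where "twisted_sum n q u s \<noteq> 0"
      proof (rule twisted_sum_not_identically_zero[of n q u])
        show "q > 1" using q(1) by (rule prime_gt_1_nat)
        thus "n \<ge> 1" using q(2) by linarith
      qed
      ultimately show False by blast
    qed
    show "F N s \<noteq> 0" if "s \<in> ball z e" for N s
    proof
      assume "F N s = 0"
      hence "e \<le> \<bar>Re (s + \<i> * of_real (t N)) - Re z\<bar>" unfolding F_def by (rule e)
      also have "\<dots> = \<bar>Re (z - s)\<bar>" by simp
      also have "\<dots> \<le> norm (z - s)" by (rule abs_Re_le_cmod)
      also have "\<dots> < e" using that by (simp add: dist_norm)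
      finally show False by simp
    qed
  qed (use e holomorphic_twisted_sum in auto)
  with z show False by simp
qed

section \<open>Vertical lines and arcs\<close>

text \<open>With real coefficients, \<open>P (- z)\<close> is the conjugate of \<open>P z\<close> on
  the imaginary axis, so the squared modulus there is the restriction of the entire function
  \<open>P z * P (- z)\<close>. If constant on a segment, this is constant everywhere; but at large
  real \<open>z\<close> the term of \<open>M\<close> makes one factor large while the term of 1
  keeps the other at least 1.\<close>

lemma norm_dirichlet_polynomial_not_constant:
  fixes S :: "nat set"
  assumes S: "finite S" "0 \<notin> S" "1 \<in> S" "M \<in> S" "M \<ge> 2" and ab: "a < b"
  shows "\<exists>t\<in>{a<..<b}. norm (\<Sum>m\<in>S. of_nat m powr Complex \<sigma> t) \<noteq> c"
proof (rule ccontr)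
  assume "\<not> ?thesis"
  hence const: "norm (\<Sum>m\<in>S. of_nat m powr Complex \<sigma> t) = c" if "t \<in> {a<..<b}" for t
    using that by blast
  define P where "P = (\<lambda>z :: complex. \<Sum>m\<in>S. of_nat m powr (of_real \<sigma> + z))"
  have pos: "m > 0" if "m \<in> S" for m using S that by (cases m) auto
  have cnj_P: "cnj (P z) = P (cnj z)" for z
    unfolding P_def using pos by (auto simp: cnj_powr intro!: sum.cong)
  have holo: "(\<lambda>z. P z * P (- z) - of_real (c\<^sup>2)) holomorphic_on UNIV"
    unfolding P_def by (intro holomorphic_intros)
  have zero: "P z * P (- z) - of_real (c\<^sup>2) = 0" for z
  proof (rule analytic_continuation[OF holo])
    have "isCont (\<lambda>t :: real. \<i> * of_real t) a" by (intro continuous_intros)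
    thus "(\<i> * of_real a) islimpt (\<lambda>t :: real. \<i> * of_real t) ` {a<..<b}"
      using ab by (intro islimpt_isCont_image islimpt_greaterThanLessThan1) (auto simp: eventually_at_filter)
    fix w assume "w \<in> (\<lambda>t :: real. \<i> * of_real t) ` {a<..<b}"
    then obtain t where t: "t \<in> {a<..<b}" "w = \<i> * of_real t" by blast
    have "P (- w) = cnj (P w)" using t by (simp add: cnj_P)
    hence "P w * P (- w) = of_real ((norm (P w))\<^sup>2)"
      by (simp only: complex_norm_square)
    also have "norm (P w) = c"
      using const[OF t(1)] t by (simp add: P_def Complex_eq)
    finally show "P w * P (- w) - of_real (c\<^sup>2) = 0" by simp
  qed auto
  obtain N where N: "real N > c\<^sup>2" using reals_Archimedean2 by blast
  \<comment> \<open>This choice makes the exponent \<open>\<sigma> + x\<close> the natural number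
    \<open>N\<close>, so that the term of \<open>M\<close> is \<open>M ^ N\<close>, which exceeds
    \<open>N\<close> and hence \<open>c\<^sup>2\<close>.\<close>
  define x where "x = real N - \<sigma>"
  have P_real: "P (of_real y) = of_real (\<Sum>m\<in>S. real m powr (\<sigma> + y))" for y
    unfolding P_def of_real_sum
  proof (intro sum.cong refl)
    fix m assume "m \<in> S"
    show "of_nat m powr (of_real \<sigma> + of_real y) = (of_real (real m powr (\<sigma> + y)) :: complex)"
      by (subst powr_of_real [symmetric]) auto
  qed
  have ge: "(\<Sum>m\<in>S. real m powr y) \<ge> real k powr y" if "k \<in> S" for k y
    using S that by (intro member_le_sum) auto
  have "real N < 2 ^ N" by (simp add: of_nat_less_two_power)
  also have "2 ^ N \<le> real M ^ N" using S by (intro power_mono) auto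
  also have "real M ^ N = real M powr (\<sigma> + x)" using S by (simp add: x_def powr_realpow)
  also have "\<dots> \<le> (\<Sum>m\<in>S. real m powr (\<sigma> + x))" by (rule ge) fact
  also have "\<dots> \<le> (\<Sum>m\<in>S. real m powr (\<sigma> + x)) * (\<Sum>m\<in>S. real m powr (\<sigma> + (- x)))"
  proof -
    have "(\<Sum>m\<in>S. real m powr (\<sigma> + (- x))) \<ge> 1" using ge[OF \<open>1 \<in> S\<close>, of "\<sigma> + (- x)"] by simp
    moreover have "(\<Sum>m\<in>S. real m powr (\<sigma> + x)) \<ge> 0" by (intro sum_nonneg) auto
    ultimately show ?thesis using mult_left_mono by fastforce
  qed
  also have "\<dots> = c\<^sup>2"
  proof -
    have "P (of_real x) * P (of_real (- x)) = of_real (c\<^sup>2)" using zero[of "of_real x"] by simp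
    thus ?thesis unfolding P_real by (simp only: flip: of_real_mult) (simp only: of_real_eq_iff)
  qed
  finally show False using N by simp
qed

text \<open>Order 1 means \<open>f w = g w * (w - z)\<close> near \<open>z\<close> with
  \<open>g z \<noteq> 0\<close>, and then the derivative is \<open>g z\<close>. The point
  \<open>w\<close> excludes the zero function, for which there is no such factorization.\<close>

lemma simple_zero_imp_deriv_nonzero:
  assumes holo: "f holomorphic_on UNIV" and "simple_zero f z" and nz: "f w \<noteq> 0"
  shows "deriv f z \<noteq> 0"
proof -
  define g where "g = zor_poly f z"
  have zero: "f z = 0" "zorder f z = 1" using assms(2) by (auto simp: simple_zero_def)
  obtain r where r: "r > 0" "g holomorphic_on cball z r"
      "\<And>w. w \<in> cball z r \<Longrightarrow> f w = g w * (w - z) \<and> g w \<noteq> 0"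
  proof -
    have "\<exists>w\<in>UNIV. f w \<noteq> 0" using nz by auto
    from zorder_exist_zero[OF holo open_UNIV connected_UNIV UNIV_I[of z] this] zero
    show ?thesis using that unfolding g_def by auto
  qed
  have "g holomorphic_on ball z r" using r(2) by (rule holomorphic_on_subset) auto
  hence g': "(g has_field_derivative deriv g z) (at z)"
    using r(1) by (intro holomorphic_derivI) auto
  have D: "((\<lambda>w. g w * (w - z)) has_field_derivative g z) (at z)"
    by (rule derivative_eq_intros g' refl)+ simp
  have ev: "\<forall>\<^sub>F w in nhds z. g w * (w - z) = f w"
    using eventually_nhds_in_open[of "ball z r" z] r by (auto elim!: eventually_mono)
  have "(f has_field_derivative g z) (at z)"
    by (rule DERIV_cong_ev[OF refl ev refl, THEN iffD1, OF D])
  hence "deriv f z = g z" by (rule DERIV_imp_deriv)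
  thus ?thesis using r(1) r(3)[of z] by simp
qed


text \<open>The interval between \<open>x\<close> and \<open>y\<close> is used. As \<open>x\<close>
  may be an end of \<open>I\<close>, one of the two radii is taken to be 0.\<close>

lemma ex_interval_of_connected:
  fixes I :: "real set"
  assumes "connected I" "x \<in> I" "y \<in> I" "x \<noteq> y"
  shows "\<exists>\<epsilon>\<^sub>1 \<epsilon>\<^sub>2. \<epsilon>\<^sub>1 \<ge> 0 \<and> \<epsilon>\<^sub>2 \<ge> 0 \<and> \<epsilon>\<^sub>1 + \<epsilon>\<^sub>2 > 0 \<and> {x - \<epsilon>\<^sub>1 <..< x + \<epsilon>\<^sub>2} \<subseteq> I"
proof (cases "x < y")
  case True
  have "{x - 0 <..< x + (y - x)} \<subseteq> I"
    using connectedD_interval[OF assms(1-3)] by auto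
  thus ?thesis using True by (intro exI[of _ 0] exI[of _ "y - x"]) auto
next
  case False
  have "{x - (x - y) <..< x + 0} \<subseteq> I"
    using connectedD_interval[OF assms(1,3,2)] by auto
  thus ?thesis using False assms by (intro exI[of _ "x - y"] exI[of _ 0]) auto
qed

text \<open>The curve is a local inverse of \<open>h\<close> applied to the arc
  \<open>- cis \<theta>\<close> through \<open>h z\<close>.\<close>

lemma unimodular_arc_lift:
  assumes holo: "h holomorphic_on UNIV" and "h z = -1" "deriv h z \<noteq> 0"
  obtains \<delta> c where "0 < \<delta>" "\<delta> \<le> 1" "continuous_on {-\<delta><..<\<delta>} c" "c 0 = z"
    "\<And>\<theta>. \<theta> \<in> {-\<delta><..<\<delta>} \<Longrightarrow> h (c \<theta>) = - cis \<theta>"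
proof -
  obtain r where r: "r > 0" "open (h ` ball z r)" "inj_on h (ball z r)"
    using has_complex_derivative_locally_invertible[OF holo UNIV_I open_UNIV assms(3)] by blast
  obtain g where g: "g holomorphic_on h ` ball z r"
      "\<And>w. w \<in> ball z r \<Longrightarrow> g (h w) = w"
    by (rule holomorphic_has_inverse[OF holomorphic_on_subset[OF holo subset_UNIV] open_ball r(3)]) (rule that)
  have "continuous_on UNIV (\<lambda>\<theta>. - cis \<theta>)"
    by (intro continuous_intros)
  hence "open ((\<lambda>\<theta>. - cis \<theta>) -` (h ` ball z r))"
    by (rule open_vimage[OF r(2)])
  moreover have "0 \<in> (\<lambda>\<theta>. - cis \<theta>) -` (h ` ball z r)"
    using r(1) assms(2) by (auto intro!: image_eqI[of _ _ z])
  ultimately obtain d where d: "d > 0" "ball 0 d \<subseteq> (\<lambda>\<theta>. - cis \<theta>) -` (h ` ball z r)"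
    using open_contains_ball by blast
  \<comment> \<open>The cap 1 keeps \<open>\<delta> / 2\<close> below \<open>pi\<close>, which later
    separates \<open>cis (\<delta> / 2)\<close> from \<open>cis 0\<close>.\<close>
  define \<delta> where "\<delta> = min d 1"
  have in_image: "- cis \<theta> \<in> h ` ball z r" if "\<theta> \<in> {-\<delta><..<\<delta>}" for \<theta>
  proof -
    have "\<theta> \<in> ball 0 d" using that by (auto simp: \<delta>_def dist_real_def)
    thus ?thesis using d(2) by blast
  qed
  show ?thesis
  proof (rule that[of \<delta> "\<lambda>\<theta>. g (- cis \<theta>)"])
    show "continuous_on {-\<delta><..<\<delta>} (\<lambda>\<theta>. g (- cis \<theta>))"
      by (rule continuous_on_compose2[OF holomorphic_on_imp_continuous_on[OF g(1)]])
         (use in_image in \<open>auto intro!: continuous_intros\<close>)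
    show "g (- cis 0) = z" using g(2)[of z] r(1) assms(2) by simp
    show "h (g (- cis \<theta>)) = - cis \<theta>" if "\<theta> \<in> {-\<delta><..<\<delta>}" for \<theta>
      using in_image[OF that] g(2) by auto
  qed (use d in \<open>auto simp: \<delta>_def\<close>)
qed

theorem theorem26:
  fixes n :: nat and s\<^sub>0 :: complex and \<sigma>\<^sub>0 t\<^sub>0 :: real
  assumes "n > 2"
    and "s\<^sub>0 = Complex \<sigma>\<^sub>0 t\<^sub>0"
    and "simple_zero (G n) s\<^sub>0"
  shows "\<exists>\<epsilon>\<^sub>1 \<epsilon>\<^sub>2 :: real. \<epsilon>\<^sub>1 \<ge> 0 \<and> \<epsilon>\<^sub>2 \<ge> 0 \<and> \<epsilon>\<^sub>1 + \<epsilon>\<^sub>2 > 0 \<and>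
           {\<sigma>\<^sub>0 - \<epsilon>\<^sub>1 <..< \<sigma>\<^sub>0 + \<epsilon>\<^sub>2} \<subseteq> R n"
proof -
  obtain q where q: "prime q" "q \<le> n" "n < 2 * q"
    using ex_prime_gt_half[of n] assms(1) by auto
  have q1: "q > 1" using q(1) prime_gt_1_nat by blast
  define S where "S = {1..n} - {q}"
  define D where "D = (\<lambda>s. \<Sum>m\<in>S. of_nat m powr s :: complex)"
  define Q where "Q = (\<lambda>s. of_nat q powr s :: complex)"
  define h where "h = (\<lambda>s. D s / Q s)"
  have Q_nz: "Q s \<noteq> 0" for s using q1 by (simp add: Q_def)
  \<comment> \<open>Zeros of the twisted sum are thus the solutions of
    \<open>h s = - u\<close>.\<close>
  have twisted: "twisted_sum n q u s = Q s * (h s + u)" for u s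
    using q q1 Q_nz[of s]
    by (subst twisted_sum_split) (auto simp: h_def D_def Q_def S_def field_simps)
  have G_eq: "G n = (\<lambda>s. Q s * (h s + 1))"
    using twisted[of 1] unfolding twisted_sum_1 by (rule ext)
  have holo: "Q holomorphic_on UNIV" "h holomorphic_on UNIV"
    using Q_nz unfolding h_def D_def Q_def by (auto intro!: holomorphic_intros)
  have zero: "G n s\<^sub>0 = 0" using assms(3) by (simp add: simple_zero_def)
  hence h_s0: "h s\<^sub>0 = -1" using Q_nz[of s\<^sub>0] by (simp add: G_eq eq_neg_iff_add_eq_0)
  have h'_s0: "deriv h s\<^sub>0 \<noteq> 0"
  proof
    assume h': "deriv h s\<^sub>0 = 0"
    have "G n holomorphic_on UNIV" unfolding G_def[abs_def] by (intro holomorphic_intros)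
    moreover have "G n 0 \<noteq> 0" using assms(1) by (simp add: G_def)
    ultimately have "deriv (G n) s\<^sub>0 \<noteq> 0"
      using assms(3) simple_zero_imp_deriv_nonzero by blast
    \<comment> \<open>In the product rule for \<open>Q s * (h s + 1)\<close> one term carries the
      factor \<open>h s\<^sub>0 + 1 = 0\<close> and the other the factor
      \<open>deriv h s\<^sub>0\<close>.\<close>
    moreover note holo[THEN holomorphic_derivI[OF _ open_UNIV UNIV_I], of s\<^sub>0, unfolded h']
    hence "(G n has_field_derivative 0) (at s\<^sub>0)"
      unfolding G_eq by (auto intro!: derivative_eq_intros simp: h_s0)
    hence "deriv (G n) s\<^sub>0 = 0" by (rule DERIV_imp_deriv)
    ultimately show False by simp
  qed
  obtain \<delta> c where \<delta>: "0 < \<delta>" "\<delta> \<le> 1" and cont: "continuous_on {-\<delta><..<\<delta>} c" and "c 0 = s\<^sub>0"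
    and h_c: "\<And>\<theta>. \<theta> \<in> {-\<delta><..<\<delta>} \<Longrightarrow> h (c \<theta>) = - cis \<theta>"
    using unimodular_arc_lift[OF holo(2) h_s0 h'_s0] by blast
  define J where "J = {-\<delta><..<\<delta>}"
  have sub: "Re ` c ` J \<subseteq> R n"
  proof (intro subsetI, elim imageE)
    fix x s \<theta> assume *: "x = Re s" "s = c \<theta>" "\<theta> \<in> J"
    hence "twisted_sum n q (cis \<theta>) s = 0" by (simp add: twisted h_c J_def)
    thus "x \<in> R n" using twisted_zero_in_R[OF q, of "cis \<theta>" s] * by simp
  qed
  have J: "connected J" "0 \<in> J" "\<delta> / 2 \<in> J" using \<delta> by (auto simp: J_def)
  have conn: "connected (c ` J)"
    using cont J by (auto simp: J_def intro: connected_continuous_image)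
  have conn_Re: "connected (Re ` c ` J)" and conn_Im: "connected (Im ` c ` J)"
    by (auto intro!: connected_continuous_image conn continuous_intros)
  have \<sigma>\<^sub>0: "\<sigma>\<^sub>0 \<in> Re ` c ` J" using \<open>c 0 = s\<^sub>0\<close> J assms(2) by force
  have "\<exists>x \<in> Re ` c ` J. x \<noteq> \<sigma>\<^sub>0"
  proof (rule ccontr)
    assume "\<not> ?thesis"
    hence Re_c: "Re (c \<theta>) = \<sigma>\<^sub>0" if "\<theta> \<in> J" for \<theta> using that by blast
    \<comment> \<open>The curve takes two different values; with constant real part its imaginary
      part must sweep an interval, so the curve covers a vertical segment.\<close>
    have "sin (\<delta> / 2) > 0" using \<delta> pi_gt3 by (intro sin_gt_zero) auto
    hence "cis (\<delta> / 2) \<noteq> cis 0" by (auto simp: complex_eq_iff)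
    hence "c (\<delta> / 2) \<noteq> c 0" using h_c[of "\<delta> / 2"] h_c[of 0] J by (auto simp: J_def)
    hence "Im (c (\<delta> / 2)) \<noteq> Im (c 0)" using Re_c J by (auto simp: complex_eq_iff)
    then obtain a b where ab: "a < b" "a \<in> Im ` c ` J" "b \<in> Im ` c ` J"
      using J by (metis imageI linorder_neqE)
    \<comment> \<open>A base other than 1 and \<open>q\<close> remains in \<open>S\<close> because
      \<open>n > 2\<close>.\<close>
    define M :: nat where "M = (if q = 2 then 3 else 2)"
    have "M \<in> S" "M \<ge> 2" "1 \<in> S" "0 \<notin> S" "finite S"
      using q q1 assms(1) by (auto simp: S_def M_def)
    then obtain t where t: "t \<in> {a<..<b}" "norm (D (Complex \<sigma>\<^sub>0 t)) \<noteq> real q powr \<sigma>\<^sub>0"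
      using norm_dirichlet_polynomial_not_constant[of S M a b \<sigma>\<^sub>0 "real q powr \<sigma>\<^sub>0"] ab(1)
      unfolding D_def by blast
    have "t \<in> Im ` c ` J"
      using t(1) ab connectedD_interval[OF conn_Im ab(2,3)] by auto
    then obtain \<theta> where \<theta>: "\<theta> \<in> J" "t = Im (c \<theta>)" by auto
    hence c: "c \<theta> = Complex \<sigma>\<^sub>0 t" using Re_c by (simp add: complex_eq_iff)
    \<comment> \<open>On the segment \<open>h\<close> has modulus 1, and the modulus of
      \<open>Q\<close> depends only on the real part; so \<open>D\<close> would have constant
      modulus there.\<close>
    have "D (c \<theta>) = - cis \<theta> * Q (c \<theta>)"
      using h_c[of \<theta>] \<theta>(1) Q_nz[of "c \<theta>"] by (simp add: h_def J_def field_simps)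
    hence "norm (D (c \<theta>)) = norm (Q (c \<theta>))" by (simp add: norm_mult)
    also have "\<dots> = real q powr \<sigma>\<^sub>0"
      using q1 by (simp add: Q_def c norm_powr_real_powr)
    finally show False using t(2) c by simp
  qed
  then obtain x where "x \<in> Re ` c ` J" "\<sigma>\<^sub>0 \<noteq> x" by blast
  from ex_interval_of_connected[OF conn_Re \<sigma>\<^sub>0 this] show ?thesis
    using sub by (meson subset_trans)
qed

end
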